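(* Let $A=\begin{bmatrix} A_{11} & A_{12} \\ A_{21} & A_{22} \end{bmatrix}$ and $H$ be self-adjoint matrices in $M_n(\mathbb{C})$, partitioned in the same way into $2$ by $2$ blocks with square diagonal blocks, such that $A_{11}$ is invertible. Then $$D\operatorname{PPT}(A)[H]=\begin{bmatrix} A_{11}^{-1} & -A_{11}^{-1}A_{12} \\ 0 & 1 \end{bmatrix}^*\,H\,\begin{bmatrix} A_{11}^{-1} & -A_{11}^{-1}A_{12} \\ 0 & 1 \end{bmatrix},$$ where $D\operatorname{PPT}(A)[H]=\frac{d}{dt}\operatorname{PPT}(A+tH)\big|_{t=0}$ and $1$ denotes the identity matrix of the size of $A_{22}$.
   Context: For $A=\begin{bmatrix} A_{11} & A_{12} \\ A_{21} & A_{22} \end{bmatrix}\in M_n(\mathbb{C})$ partitioned into blocks, with $A_{11}$ and $A_{22}$ square (not necessarily of the same size) and $A_{11}$ invertible, the principal pivot transform of $A$ is the matrix (with the same partition) $$\operatorname{PPT}(A)=\begin{bmatrix} -A_{11}^{-1} & A_{11}^{-1}A_{12} \\ A_{21}A_{11}^{-1} & A_{22}-A_{21}A_{11}^{-1}A_{12} \end{bmatrix}.$$ Here $X^*$ denotes the conjugate transpose of $X$, and $t$ is a real variable (for $t$ near $0$ the $(1,1)$ block of $A+tH$ is invertible, so $\operatorname{PPT}(A+tH)$ is defined). *)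

theory Defs
  imports "HOL-Analysis.Analysis"
begin

text \<open>
  A partitioned matrix is indexed by a sum type: rows and columns \<^term>\<open>Inl i\<close> belong to
  the first diagonal block, rows and columns \<^term>\<open>Inr j\<close> to the second one.
\<close>

definition block_mat ::
  "'a^'m::finite^'m \<Rightarrow> 'a^'n::finite^'m \<Rightarrow> 'a^'m^'n \<Rightarrow> 'a^'n^'n \<Rightarrow> 'a^('m + 'n)^('m + 'n)" where
  "block_mat A11 A12 A21 A22 = (\<chi> i j. case i of
      Inl a \<Rightarrow> (case j of Inl b \<Rightarrow> A11 $ a $ b | Inr b \<Rightarrow> A12 $ a $ b)
    | Inr a \<Rightarrow> (case j of Inl b \<Rightarrow> A21 $ a $ b | Inr b \<Rightarrow> A22 $ a $ b))"

definition block11 :: "'a^('m::finite + 'n::finite)^('m + 'n) \<Rightarrow> 'a^'m^'m" where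
  "block11 A = (\<chi> i j. A $ Inl i $ Inl j)"

definition block12 :: "'a^('m::finite + 'n::finite)^('m + 'n) \<Rightarrow> 'a^'n^'m" where
  "block12 A = (\<chi> i j. A $ Inl i $ Inr j)"

definition block21 :: "'a^('m::finite + 'n::finite)^('m + 'n) \<Rightarrow> 'a^'m^'n" where
  "block21 A = (\<chi> i j. A $ Inr i $ Inl j)"

definition block22 :: "'a^('m::finite + 'n::finite)^('m + 'n) \<Rightarrow> 'a^'n^'n" where
  "block22 A = (\<chi> i j. A $ Inr i $ Inr j)"

lemma block_simps [simp]:
  "block11 (block_mat A11 A12 A21 A22) = A11"
  "block12 (block_mat A11 A12 A21 A22) = A12"
  "block21 (block_mat A11 A12 A21 A22) = A21"
  "block22 (block_mat A11 A12 A21 A22) = A22"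
  by (simp_all add: block_mat_def block11_def block12_def block21_def block22_def vec_eq_iff)

lemma block_mat_blocks [simp]:
  "block_mat (block11 A) (block12 A) (block21 A) (block22 A) = A"
  by (simp add: block_mat_def block11_def block12_def block21_def block22_def vec_eq_iff
      split: sum.split)

text \<open>
  The principal pivot transform is meaningful only if the \<open>(1,1)\<close> block is invertible;
  otherwise \<^const>\<open>matrix_inv\<close> returns an unspecified matrix.
\<close>

definition PPT :: "complex^('m::finite + 'n::finite)^('m + 'n) \<Rightarrow> complex^('m + 'n)^('m + 'n)" where
  "PPT A = block_mat
     (- matrix_inv (block11 A))
     (matrix_inv (block11 A) ** block12 A)
     (block21 A ** matrix_inv (block11 A))
     (block22 A - block21 A ** matrix_inv (block11 A) ** block12 A)"

definition conj_transpose :: "complex^'n::finite^'m::finite \<Rightarrow> complex^'m^'n" where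
  "conj_transpose X = (\<chi> i j. cnj (X $ j $ i))"

definition self_adjoint :: "complex^'n::finite^'n \<Rightarrow> bool" where
  "self_adjoint X \<longleftrightarrow> conj_transpose X = X"

end

theory Submission imports Defs begin

text \<open>
  The blocks of \<open>PPT (A + t H)\<close> are built from \<open>matrix_inv (A11 + t H11)\<close> by products with affine
  functions of \<open>t\<close>, so everything reduces to the derivative \<open>- B H11 B\<close> of the inverse,
  \<open>B = matrix_inv A11\<close>.  That follows from the resolvent identity
  \<open>Y\<inverse> - X\<inverse> = - Y\<inverse> (Y - X) X\<inverse>\<close> together with continuity of the inverse, which is read off from
  Cramer's rule.  Self-adjointness of \<open>A\<close> identifies \<open>(B A12)\<^sup>*\<close> with \<open>A21 B\<close> in the final comparison.
\<close>

lemma matrix_inv_eqs: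
  fixes A :: "'a::semiring_1^'n^'m"
  assumes "invertible A"
  shows "A ** matrix_inv A = mat 1" "matrix_inv A ** A = mat 1"
  using assms someI_ex[of "\<lambda>B. A ** B = mat 1 \<and> B ** A = mat 1"]
  by (auto simp: invertible_def matrix_inv_def)

lemma matrix_mult_minus_left: "(- A) ** B = - (A ** B)"
  for A :: "'a::ring_1^'n^'m"
  by (simp add: matrix_matrix_mult_def vec_eq_iff sum_negf)

lemma matrix_mult_minus_right: "A ** (- B) = - (A ** B)"
  for A :: "'a::ring_1^'n^'m"
  by (simp add: matrix_matrix_mult_def vec_eq_iff sum_negf)

lemma matrix_add_rdistrib: "(A + B) ** C = A ** C + B ** C"
  for A B :: "'a::semiring_1^'n^'m"
  by (simp add: matrix_matrix_mult_def vec_eq_iff distrib_right sum.distrib)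

lemma matrix_diff_ldistrib: "A ** (B - C) = A ** B - A ** C"
  for A :: "'a::ring_1^'n^'m"
  using matrix_add_ldistrib[of A B "- C"] by (simp add: matrix_mult_minus_right)

lemma matrix_diff_rdistrib: "(A - B) ** C = A ** C - B ** C"
  for A B :: "'a::ring_1^'n^'m"
  using matrix_add_rdistrib[of A "- B" C] by (simp add: matrix_mult_minus_left)

text \<open>In finite dimension bilinearity already implies boundedness, hence the class
  \<open>euclidean_space\<close> on the entries. The product rule and limits of matrix products come
  from here.\<close>

lemma bounded_bilinear_matrix_mult:
  "bounded_bilinear ((**) :: 'a::{euclidean_space,real_normed_algebra_1}^'n^'m \<Rightarrow> 'a^'p^'n \<Rightarrow> 'a^'p^'m)"
  unfolding bilinear_conv_bounded_bilinear[symmetric] bilinear_def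
  by (auto intro!: linearI
      simp: matrix_matrix_mult_def vec_eq_iff scaleR_sum_right distrib_left distrib_right sum.distrib)

lemma matrix_inv_resolvent:
  fixes X Y :: "'a::ring_1^'n^'n"
  assumes "invertible X" "invertible Y"
  shows "matrix_inv Y - matrix_inv X = - (matrix_inv Y ** (Y - X) ** matrix_inv X)"
proof -
  have "matrix_inv Y ** (Y - X) ** matrix_inv X
      = (matrix_inv Y ** Y) ** matrix_inv X - matrix_inv Y ** (X ** matrix_inv X)"
    by (simp add: matrix_diff_ldistrib matrix_diff_rdistrib matrix_mul_assoc)
  then show ?thesis
    using assms by (simp add: matrix_inv_eqs)
qed

lemma tendsto_det [tendsto_intros]:
  fixes f :: "'b \<Rightarrow> 'a::{real_normed_field}^'n^'n"
  assumes "(f \<longlongrightarrow> X) F"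
  shows "((\<lambda>x. det (f x)) \<longlongrightarrow> det X) F"
  unfolding det_def by (intro tendsto_intros assms)

text \<open>Column \<open>k\<close> of the inverse solves \<open>A *v x = axis k 1\<close>, so
  Cramer's rule writes every entry as a quotient of determinants, that is, as an expression visibly
  continuous in the entries of \<open>A\<close>.\<close>

lemma matrix_inv_cramer:
  fixes A :: "'a::field^'n^'n"
  assumes "invertible A"
  shows "matrix_inv A = (\<chi> i k. det (\<chi> a b. if b = i then axis k 1 $ a else A $ a $ b) / det A)"
proof -
  have "A *v (matrix_inv A *v axis k 1) = axis k 1" for k
    using assms by (simp add: matrix_vector_mul_assoc matrix_inv_eqs)
  then have "matrix_inv A *v axis k 1
      = (\<chi> i. det (\<chi> a b. if b = i then axis k 1 $ a else A $ a $ b) / det A)" for k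
    using assms by (subst (asm) cramer) (auto simp: invertible_det_nz)
  moreover have "(matrix_inv A *v axis k 1) $ i = matrix_inv A $ i $ k" for i k
    by (simp add: matrix_vector_mult_def axis_def if_distrib cong: if_cong)
  ultimately show ?thesis
    by (simp add: vec_eq_iff)
qed

text \<open>The determinant is continuous and nonzero at \<open>X\<close>, so it stays nonzero along
  the filter.\<close>

lemma eventually_invertible:
  fixes f :: "'b \<Rightarrow> 'a::{real_normed_field}^'n^'n"
  assumes "(f \<longlongrightarrow> X) F" "invertible X"
  shows "eventually (\<lambda>x. invertible (f x)) F"
  using tendsto_imp_eventually_ne[OF tendsto_det[OF assms(1)], of 0] assms(2)
  by (simp add: invertible_det_nz)

lemma tendsto_matrix_inv:
  fixes f :: "'b \<Rightarrow> 'a::{real_normed_field}^'n^'n"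
  assumes f: "(f \<longlongrightarrow> X) F" and X: "invertible X"
  shows "((\<lambda>x. matrix_inv (f x)) \<longlongrightarrow> matrix_inv X) F"
proof -
  have "((\<lambda>x. if b = i then axis k 1 $ a else f x $ a $ b) \<longlongrightarrow>
      (if b = i then axis k 1 $ a else X $ a $ b)) F" for a b i k
    by (auto intro!: tendsto_intros f)
  then have "((\<lambda>x. \<chi> i k. det (\<chi> a b. if b = i then axis k 1 $ a else f x $ a $ b) / det (f x)) \<longlongrightarrow>
      (\<chi> i k. det (\<chi> a b. if b = i then axis k 1 $ a else X $ a $ b) / det X)) F"
    using X by (intro tendsto_intros f) (auto simp: invertible_det_nz)
  \<comment> \<open>Cramer's formula represents \<open>matrix_inv (f x)\<close> only where
    \<open>f x\<close> is invertible; this holds eventually, which is enough for the limit.\<close>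
  then show ?thesis
    unfolding matrix_inv_cramer[OF X]
    by (rule Lim_transform_eventually)
      (rule eventually_mono[OF eventually_invertible[OF f X]], simp add: matrix_inv_cramer)
qed

text \<open>The difference quotient is the form to which the resolvent identity applies directly.
  The limit ignores \<open>y = x\<close>, so division by zero there is harmless.\<close>

lemma has_vector_derivative_iff_slope:
  "(f has_vector_derivative D) (at x within S) \<longleftrightarrow>
    ((\<lambda>y. (f y - f x) /\<^sub>R (y - x)) \<longlongrightarrow> D) (at x within S)"
proof -
  have "norm ((f y - f x) - (y - x) *\<^sub>R D) / norm (y - x) = norm ((f y - f x) /\<^sub>R (y - x) - D)"
    if "y \<noteq> x" for y
  proof -
    have "(f y - f x) /\<^sub>R (y - x) - D = ((f y - f x) - (y - x) *\<^sub>R D) /\<^sub>R (y - x)"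
      using that by (simp add: scaleR_diff_right)
    then show ?thesis
      by (simp add: divide_inverse mult.commute)
  qed
  then have "((\<lambda>y. norm ((f y - f x) - (y - x) *\<^sub>R D) / norm (y - x)) \<longlongrightarrow> 0) (at x within S)
      \<longleftrightarrow> ((\<lambda>y. norm ((f y - f x) /\<^sub>R (y - x) - D)) \<longlongrightarrow> 0) (at x within S)"
    by (intro Lim_cong_within) auto
  then show ?thesis
    by (simp add: has_vector_derivative_def has_derivative_iff_norm bounded_linear_scaleR_left
        tendsto_norm_zero_iff LIM_zero_iff)
qed

lemma has_vector_derivative_matrix_inv:
  fixes f :: "real \<Rightarrow> 'a::{euclidean_space,real_normed_field}^'n^'n"
  assumes f: "(f has_vector_derivative D) (at x within S)" and inv: "invertible (f x)"
  shows "((\<lambda>t. matrix_inv (f t)) has_vector_derivative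
    - (matrix_inv (f x) ** D ** matrix_inv (f x))) (at x within S)"
proof -
  interpret bounded_bilinear "(**) :: 'a^'n^'n \<Rightarrow> 'a^'n^'n \<Rightarrow> 'a^'n^'n"
    by (rule bounded_bilinear_matrix_mult)
  have lim: "(f \<longlongrightarrow> f x) (at x within S)"
    using has_vector_derivative_continuous[OF f] by (simp add: continuous_within)
  \<comment> \<open>This is the slope of the inverse after the resolvent identity: the left factor
    converges by continuity of the inverse, the middle one is the slope of \<open>f\<close>, and the
    right one is constant.\<close>
  have "((\<lambda>y. - (matrix_inv (f y) ** ((f y - f x) /\<^sub>R (y - x)) ** matrix_inv (f x))) \<longlongrightarrow>
      - (matrix_inv (f x) ** D ** matrix_inv (f x))) (at x within S)"
    using f unfolding has_vector_derivative_iff_slope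
    by (intro tendsto_minus tendsto tendsto_matrix_inv[OF lim inv] tendsto_const)
  moreover have "eventually (\<lambda>y. - (matrix_inv (f y) ** ((f y - f x) /\<^sub>R (y - x)) ** matrix_inv (f x))
      = (matrix_inv (f y) - matrix_inv (f x)) /\<^sub>R (y - x)) (at x within S)"
    using eventually_invertible[OF lim inv]
    by eventually_elim (simp add: matrix_inv_resolvent[OF inv] scaleR_left scaleR_right)
  ultimately show ?thesis
    unfolding has_vector_derivative_iff_slope by (rule Lim_transform_eventually)
qed

lemma block_mat_mult:
  "block_mat A B C D ** block_mat E F G H =
    block_mat (A ** E + B ** G) (A ** F + B ** H) (C ** E + D ** G) (C ** F + D ** H)"
proof -
  \<comment> \<open>The inner index of the product runs over a sum type, so each entry splits into
    the two terms of the block formula.\<close>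
  have split: "sum g UNIV = (\<Sum>a\<in>UNIV. g (Inl a)) + (\<Sum>b\<in>UNIV. g (Inr b))"
    for g :: "('p::finite + 'q::finite) \<Rightarrow> 'r::comm_monoid_add"
    using sum.Plus[of UNIV UNIV g] by (simp add: UNIV_Plus_UNIV)
  show ?thesis
    by (simp add: block_mat_def matrix_matrix_mult_def vec_eq_iff split split: sum.split)
qed

lemma conj_transpose_block_mat:
  "conj_transpose (block_mat A B C D) =
    block_mat (conj_transpose A) (conj_transpose C) (conj_transpose B) (conj_transpose D)"
  by (simp add: conj_transpose_def block_mat_def vec_eq_iff split: sum.split)

lemma conj_transpose_mult: "conj_transpose (A ** B) = conj_transpose B ** conj_transpose A"
  by (simp add: conj_transpose_def matrix_matrix_mult_def vec_eq_iff mult.commute)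

lemma conj_transpose_minus: "conj_transpose (- A) = - conj_transpose A"
  by (simp add: conj_transpose_def vec_eq_iff)

lemma conj_transpose_mat: "conj_transpose (mat c) = mat (cnj c)"
  by (simp add: conj_transpose_def mat_def vec_eq_iff)

lemma conj_transpose_zero: "conj_transpose 0 = 0"
  by (simp add: conj_transpose_def vec_eq_iff)

text \<open>Conjugate-transposing the two inverse equations gives a two-sided inverse of
  \<open>conj_transpose A\<close>, and such an inverse is unique.\<close>

lemma conj_transpose_matrix_inv:
  assumes "invertible A"
  shows "conj_transpose (matrix_inv A) = matrix_inv (conj_transpose A)"
proof -
  have "conj_transpose A ** conj_transpose (matrix_inv A) = mat 1"
    "conj_transpose (matrix_inv A) ** conj_transpose A = mat 1"
    using assms by (simp_all add: conj_transpose_mult[symmetric] matrix_inv_eqs conj_transpose_mat)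
  then show ?thesis
    using matrix_inv_eqs[of "conj_transpose A"] unfolding invertible_def
    by (metis matrix_mul_assoc matrix_mul_lid matrix_mul_rid)
qed

text \<open>Assembling four blocks is linear, hence bounded in finite dimension, and so commutes
  with differentiation.\<close>

lemma has_vector_derivative_block_mat:
  fixes A :: "real \<Rightarrow> 'a::euclidean_space^'m::finite^'m" and D :: "real \<Rightarrow> 'a^'n::finite^'n"
  assumes "(A has_vector_derivative A') (at x within S)" "(B has_vector_derivative B') (at x within S)"
    "(C has_vector_derivative C') (at x within S)" "(D has_vector_derivative D') (at x within S)"
  shows "((\<lambda>t. block_mat (A t) (B t) (C t) (D t)) has_vector_derivative block_mat A' B' C' D')
    (at x within S)"
proof -
  have "bounded_linear (\<lambda>(A :: 'a^'m^'m, B, C, D :: 'a^'n^'n). block_mat A B C D)"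
    unfolding linear_conv_bounded_linear[symmetric]
    by (rule linearI) (auto simp: block_mat_def vec_eq_iff split: sum.split)
  from bounded_linear.has_vector_derivative[OF this
      has_vector_derivative_Pair[OF assms(1) has_vector_derivative_Pair[OF assms(2)
        has_vector_derivative_Pair[OF assms(3,4)]]]]
  show ?thesis by simp
qed

theorem proposition2p2:
  fixes A H :: "complex^('m::finite + 'n::finite)^('m + 'n)"
    and A11 :: "complex^'m^'m" and A12 :: "complex^'n^'m"
    and A21 :: "complex^'m^'n" and A22 :: "complex^'n^'n"
  assumes "A = block_mat A11 A12 A21 A22"
    and "self_adjoint A"
    and "self_adjoint H"
    and "invertible A11"
  shows "((\<lambda>t::real. PPT (A + t *\<^sub>R H)) has_vector_derivative
           conj_transpose (block_mat (matrix_inv A11) (- (matrix_inv A11 ** A12)) 0 (mat 1))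
             ** H ** block_mat (matrix_inv A11) (- (matrix_inv A11 ** A12)) 0 (mat 1)) (at 0)"
proof -
  define B where "B = matrix_inv A11"
  define H11 H12 H21 H22 where "H11 = block11 H" and "H12 = block12 H"
    and "H21 = block21 H" and "H22 = block22 H"
  have H: "H = block_mat H11 H12 H21 H22"
    by (simp add: H11_def H12_def H21_def H22_def)
  have AH: "A + t *\<^sub>R H = block_mat (A11 + t *\<^sub>R H11) (A12 + t *\<^sub>R H12)
      (A21 + t *\<^sub>R H21) (A22 + t *\<^sub>R H22)" for t
    unfolding assms(1) H by (simp add: block_mat_def vec_eq_iff split: sum.split)
  have affine: "((\<lambda>t::real. X + t *\<^sub>R Y) has_vector_derivative Y) (at 0)"
    for X Y :: "'x::real_normed_vector"
    by (auto intro!: derivative_eq_intros)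
  have inv: "((\<lambda>t. matrix_inv (A11 + t *\<^sub>R H11)) has_vector_derivative - (B ** H11 ** B)) (at 0)"
    using has_vector_derivative_matrix_inv[OF affine[of A11 H11]] assms(4) by (simp add: B_def)
  note mult = bounded_bilinear.has_vector_derivative[OF bounded_bilinear_matrix_mult]
  \<comment> \<open>The entries are left in the shape the product rule yields; in the last block the
    triple product is differentiated as \<open>(A21 B) A12\<close>.\<close>
  have deriv: "((\<lambda>t. PPT (A + t *\<^sub>R H)) has_vector_derivative block_mat
      (B ** H11 ** B)
      (B ** H12 - B ** H11 ** B ** A12)
      (H21 ** B - A21 ** B ** H11 ** B)
      (H22 - (A21 ** B ** H12 + (H21 ** B - A21 ** B ** H11 ** B) ** A12))) (at 0)"
    unfolding PPT_def AH block_simps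
    using has_vector_derivative_minus[OF inv] mult[OF inv affine[of A12 H12]]
      mult[OF affine[of A21 H21] inv]
      has_vector_derivative_diff[OF affine[of A22 H22]
        mult[OF mult[OF affine[of A21 H21] inv] affine[of A12 H12]]]
    by (intro has_vector_derivative_block_mat)
      (simp_all add: B_def matrix_mult_minus_left matrix_mult_minus_right matrix_mul_assoc)
  \<comment> \<open>Comparing the (1,1) and (2,1) blocks of \<open>conj_transpose A = A\<close>
    gives the two equations.\<close>
  have adj: "conj_transpose A11 = A11" "conj_transpose A12 = A21"
    using assms(2) arg_cong[of "block_mat _ _ _ _" "block_mat _ _ _ _" block11]
      arg_cong[of "block_mat _ _ _ _" "block_mat _ _ _ _" block21]
    unfolding self_adjoint_def assms(1) conj_transpose_block_mat by fastforce+
  \<comment> \<open>Together with \<open>adj\<close> this turns the adjoint of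
    \<open>B ** A12\<close> into \<open>A21 ** B\<close>, so that the congruence multiplies out to
    the four blocks of \<open>deriv\<close>.\<close>
  have "conj_transpose B = B"
    using assms(4) by (simp add: B_def conj_transpose_matrix_inv adj)
  then have "conj_transpose (block_mat B (- (B ** A12)) 0 (mat 1)) ** H
        ** block_mat B (- (B ** A12)) 0 (mat 1)
      = block_mat (B ** H11 ** B)
      (B ** H12 - B ** H11 ** B ** A12)
      (H21 ** B - A21 ** B ** H11 ** B)
      (H22 - (A21 ** B ** H12 + (H21 ** B - A21 ** B ** H11 ** B) ** A12))"
    unfolding H
    by (simp add: conj_transpose_block_mat conj_transpose_mult conj_transpose_minus
        conj_transpose_zero conj_transpose_mat adj block_mat_mult matrix_mult_minus_left
        matrix_mult_minus_right matrix_mul_assoc matrix_add_rdistrib matrix_diff_rdistrib algebra_simps)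
  with deriv show ?thesis
    by (simp add: B_def)
qed

end
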